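(* Let $\mathbb{k}$ be an algebraically closed field, let $p,q\in\mathbb{k}^*$ with $pq\neq1$ have finite orders $\operatorname{ord}(p)=m$, $\operatorname{ord}(q)=n$, and let $l=\operatorname{lcm}(m,n)$. Let $(\mu,\lambda,\gamma),(\mu',\lambda',\gamma')\in(\mathbb{k}^* )^3$. Then $\mathcal{V}_1(\mu,\lambda,\gamma)\cong\mathcal{V}_1(\mu',\lambda',\gamma')$ as right $\mathcal{H}_{p,q}$-modules if and only if $\mu^l=(\mu')^l$ and there exists $0\le k\le l-1$ such that $\lambda=p^k\lambda'$ and $\gamma=q^{-k}\gamma'$.
   Context: For $p,q\in\mathbb{k}^*=\mathbb{k}\setminus\{0\}$, $\mathcal{H}_{p,q}$ is the $\mathbb{k}$-algebra generated by $x,y,z$ subject to the relations $zx=p^{-1}xz$, $zy=pyz$, $yx-qxy=z$. All modules are right modules. $\mathcal{V}_1(\mu,\lambda,\gamma)$ is the $\mathbb{k}$-vector space with basis $\{v_k\mid 0\le k\le l-1\}$ and right $\mathcal{H}_{p,q}$-module structure given by: $v_kz=p^k\lambda v_k$; $v_kx=\mu v_{k+1}$ for $0\le k\le l-2$ and $v_{l-1}x=\mu v_0$; $v_ky=\mu^{-1}q^{-k}\frac{pq\gamma-(pq)^k\lambda}{pq-1}v_{k-1}$ for $1\le k\le l-1$ and $v_0y=\mu^{-1}\frac{pq\gamma-\lambda}{pq-1}v_{l-1}$. *)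

theory Defs
  imports
    "HOL-Algebra.Multiplicative_Group"
    "HOL-Algebra.QuotRing"
    "HOL-Algebra.Algebraic_Closure_Type"
    "HOL-Library.Poly_Mapping"
begin

section \<open>Right modules over a not necessarily commutative ring\<close>

text \<open>
  The library's \<^locale>\<open>module\<close> asks for a commutative ring of scalars. The record type
  \<^typ>\<open>('a, 'b) module\<close> is reused here, but its scalar multiplication is to be read from the
  right: \<open>v \<cdot>\<^bsub>M\<^esub> a\<close> stands for \<^term>\<open>Module.smult M a v\<close>. The ring multiplication and
  unit of \<open>M\<close> play no role (as for \<^locale>\<open>module\<close>).
\<close>

abbreviation right_smult :: "('a, 'b, 'c) module_scheme \<Rightarrow> 'b \<Rightarrow> 'a \<Rightarrow> 'b"
  where "right_smult M v a \<equiv> Module.smult M a v"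

locale right_module = R?: ring R + M?: abelian_group M
  for R :: "('a, 'd) ring_scheme" (structure) and M :: "('a, 'b, 'c) module_scheme" (structure) +
  assumes right_smult_closed:
      "\<lbrakk>v \<in> carrier M; a \<in> carrier R\<rbrakk> \<Longrightarrow> right_smult M v a \<in> carrier M"
    and right_smult_add_scalar:
      "\<lbrakk>v \<in> carrier M; a \<in> carrier R; b \<in> carrier R\<rbrakk> \<Longrightarrow>
        right_smult M v (a \<oplus>\<^bsub>R\<^esub> b) = right_smult M v a \<oplus>\<^bsub>M\<^esub> right_smult M v b"
    and right_smult_add_vector:
      "\<lbrakk>u \<in> carrier M; v \<in> carrier M; a \<in> carrier R\<rbrakk> \<Longrightarrow>
        right_smult M (u \<oplus>\<^bsub>M\<^esub> v) a = right_smult M u a \<oplus>\<^bsub>M\<^esub> right_smult M v a"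
    and right_smult_assoc:
      "\<lbrakk>v \<in> carrier M; a \<in> carrier R; b \<in> carrier R\<rbrakk> \<Longrightarrow>
        right_smult M v (a \<otimes>\<^bsub>R\<^esub> b) = right_smult M (right_smult M v a) b"
    and right_smult_one:
      "v \<in> carrier M \<Longrightarrow> right_smult M v \<one>\<^bsub>R\<^esub> = v"

definition right_module_hom ::
  "('a, 'd) ring_scheme \<Rightarrow> ('a, 'b, 'e) module_scheme \<Rightarrow> ('a, 'c, 'f) module_scheme \<Rightarrow> ('b \<Rightarrow> 'c) set"
  where "right_module_hom R M N =
    {\<phi>. (\<forall>v\<in>carrier M. \<phi> v \<in> carrier N) \<and>
        (\<forall>u\<in>carrier M. \<forall>v\<in>carrier M. \<phi> (u \<oplus>\<^bsub>M\<^esub> v) = \<phi> u \<oplus>\<^bsub>N\<^esub> \<phi> v) \<and>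
        (\<forall>v\<in>carrier M. \<forall>a\<in>carrier R. \<phi> (right_smult M v a) = right_smult N (\<phi> v) a)}"

definition right_module_isomorphic ::
  "('a, 'd) ring_scheme \<Rightarrow> ('a, 'b, 'e) module_scheme \<Rightarrow> ('a, 'c, 'f) module_scheme \<Rightarrow> bool"
  where "right_module_isomorphic R M N \<longleftrightarrow>
    (\<exists>\<phi>\<in>right_module_hom R M N. bij_betw \<phi> (carrier M) (carrier N))"


section \<open>Multiplicative order\<close>

text \<open>As for \<^const>\<open>group.ord\<close>, the value is \<open>0\<close> for elements of infinite order.\<close>

definition mult_order :: "'k::field \<Rightarrow> nat"
  where "mult_order a = group.ord (Multiplicative_Group.mult_of ring_of_type_algebra) a"


section \<open>The algebra \<open>H\<^bsub>p,q\<^esub>\<close>\<close>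

datatype generator = gen_x | gen_y | gen_z

text \<open>Words form the free monoid, written additively as \<^typ>\<open>'a \<Rightarrow>\<^sub>0 'b\<close> requires; hence
  \<open>word \<Rightarrow>\<^sub>0 'k\<close> with its convolution product is the free associative algebra.\<close>

datatype word = Word (letters: "generator list")

instantiation word :: monoid_add
begin

definition zero_word :: word where "0 = Word []"

definition plus_word :: "word \<Rightarrow> word \<Rightarrow> word" where "u + v = Word (letters u @ letters v)"

instance by standard (simp_all add: zero_word_def plus_word_def)

end

type_synonym 'k free_alg = "word \<Rightarrow>\<^sub>0 'k"

definition gen :: "generator \<Rightarrow> 'k::field free_alg"
  where "gen g = Poly_Mapping.single (Word [g]) 1"

definition const :: "'k::field \<Rightarrow> 'k free_alg"
  where "const c = Poly_Mapping.single 0 c"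

definition H_relations :: "'k::field \<Rightarrow> 'k \<Rightarrow> 'k free_alg set"
  where "H_relations p q =
    {gen gen_z * gen gen_x - const (inverse p) * (gen gen_x * gen gen_z),
     gen gen_z * gen gen_y - const p * (gen gen_y * gen gen_z),
     gen gen_y * gen gen_x - const q * (gen gen_x * gen gen_y) - gen gen_z}"

definition H_ideal :: "'k::field \<Rightarrow> 'k \<Rightarrow> 'k free_alg set"
  where "H_ideal p q = genideal ring_of_type_algebra (H_relations p q)"

definition H_alg :: "'k::field \<Rightarrow> 'k \<Rightarrow> 'k free_alg set ring"
  where "H_alg p q = ring_of_type_algebra Quot H_ideal p q"

text \<open>The canonical projection; the scalar \<open>c\<close> and the generators of \<open>H\<^bsub>p,q\<^esub>\<close> are the images
  of \<^term>\<open>const c\<close> and of \<^term>\<open>gen g\<close>.\<close>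

definition H_class :: "'k::field \<Rightarrow> 'k \<Rightarrow> 'k free_alg \<Rightarrow> 'k free_alg set"
  where "H_class p q f = H_ideal p q +>\<^bsub>ring_of_type_algebra\<^esub> f"


section \<open>The modules \<open>V\<^sub>1(\<mu>, \<lambda>, \<gamma>)\<close>\<close>

text \<open>Vectors are coordinate functions vanishing outside \<open>{0..<l}\<close>.\<close>

definition basis_vec :: "nat \<Rightarrow> nat \<Rightarrow> 'k::field"
  where "basis_vec k = (\<lambda>i. if i = k then 1 else 0)"

definition scale :: "'k::field \<Rightarrow> (nat \<Rightarrow> 'k) \<Rightarrow> nat \<Rightarrow> 'k"
  where "scale c v = (\<lambda>i. c * v i)"

text \<open>The vector \<open>v\<^sub>k \<cdot> g\<close> for a generator \<open>g\<close>.\<close>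

fun V1_basis_act :: "'k::field \<Rightarrow> 'k \<Rightarrow> nat \<Rightarrow> 'k \<Rightarrow> 'k \<Rightarrow> 'k \<Rightarrow> generator \<Rightarrow> nat \<Rightarrow> nat \<Rightarrow> 'k"
  where
    "V1_basis_act p q l \<mu> lam \<gamma> gen_z k = scale (p ^ k * lam) (basis_vec k)"
  | "V1_basis_act p q l \<mu> lam \<gamma> gen_x k =
      (if k = l - 1 then scale \<mu> (basis_vec 0) else scale \<mu> (basis_vec (k + 1)))"
  | "V1_basis_act p q l \<mu> lam \<gamma> gen_y k =
      (if k = 0 then scale (inverse \<mu> * ((p * q * \<gamma> - lam) / (p * q - 1))) (basis_vec (l - 1))
       else scale (inverse \<mu> * inverse (q ^ k) * ((p * q * \<gamma> - (p * q) ^ k * lam) / (p * q - 1)))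
              (basis_vec (k - 1)))"

definition V1_gen_act ::
  "'k::field \<Rightarrow> 'k \<Rightarrow> nat \<Rightarrow> 'k \<Rightarrow> 'k \<Rightarrow> 'k \<Rightarrow> generator \<Rightarrow> (nat \<Rightarrow> 'k) \<Rightarrow> nat \<Rightarrow> 'k"
  where "V1_gen_act p q l \<mu> lam \<gamma> g v = (\<lambda>i. \<Sum>k<l. v k * V1_basis_act p q l \<mu> lam \<gamma> g k i)"

text \<open>Since this is a right action, the leftmost letter of a word acts first.\<close>

definition V1_word_act ::
  "'k::field \<Rightarrow> 'k \<Rightarrow> nat \<Rightarrow> 'k \<Rightarrow> 'k \<Rightarrow> 'k \<Rightarrow> word \<Rightarrow> (nat \<Rightarrow> 'k) \<Rightarrow> nat \<Rightarrow> 'k"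
  where "V1_word_act p q l \<mu> lam \<gamma> w = fold (V1_gen_act p q l \<mu> lam \<gamma>) (letters w)"

definition V1_free_act ::
  "'k::field \<Rightarrow> 'k \<Rightarrow> nat \<Rightarrow> 'k \<Rightarrow> 'k \<Rightarrow> 'k \<Rightarrow> 'k free_alg \<Rightarrow> (nat \<Rightarrow> 'k) \<Rightarrow> nat \<Rightarrow> 'k"
  where "V1_free_act p q l \<mu> lam \<gamma> f v =
    (\<lambda>i. \<Sum>w\<in>Poly_Mapping.keys f. Poly_Mapping.lookup f w * V1_word_act p q l \<mu> lam \<gamma> w v i)"

text \<open>A coset acts through any of its representatives; independence of the representative is
  proved in \<open>V1_smult_class\<close> below.\<close>

definition V1 ::
  "'k::field \<Rightarrow> 'k \<Rightarrow> nat \<Rightarrow> 'k \<Rightarrow> 'k \<Rightarrow> 'k \<Rightarrow> ('k free_alg set, nat \<Rightarrow> 'k) module"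
  where "V1 p q l \<mu> lam \<gamma> =
    \<lparr>carrier = {v. \<forall>i\<ge>l. v i = 0},
     monoid.mult = (\<lambda>u v. undefined), one = undefined,
     zero = (\<lambda>i. 0), add = (\<lambda>u v i. u i + v i),
     module.smult = (\<lambda>a v. the_elem ((\<lambda>f. V1_free_act p q l \<mu> lam \<gamma> f v) ` a))\<rparr>"


subsection \<open>The action is well defined\<close>

lemma free_alg_ring: "ring (ring_of_type_algebra :: 'k::field free_alg ring)"
proof -
  have "\<exists>y. x + y = 0" for x :: "'k free_alg"
    using add.right_inverse by blast
  thus ?thesis
    unfolding ring_of_type_algebra_def using add.right_inverse
    by unfold_locales (auto simp: algebra_simps Units_def)
qed

lemma free_alg_induct [case_names zero single add]:
  fixes f :: "'a \<Rightarrow>\<^sub>0 'b::ab_group_add"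
  assumes "P 0" and s: "\<And>w c. P (Poly_Mapping.single w c)" and a: "\<And>f g. P f \<Longrightarrow> P g \<Longrightarrow> P (f + g)"
  shows "P f"
proof (induction f rule: update_induct)
  case const
  then show ?case using assms(1) by simp
next
  case (update f a b)
  have "Poly_Mapping.update a b f = f + Poly_Mapping.single a b"
    using update.hyps
    by (intro poly_mapping_eqI) (auto simp: lookup_update lookup_add lookup_single in_keys_iff when_def)
  then show ?case using a s update.IH by simp
qed

context
  fixes p q :: "'k::field" and l :: nat and \<mu> lam \<gamma> :: 'k
begin

private abbreviation (input) "bact \<equiv> V1_basis_act p q l \<mu> lam \<gamma>"
private abbreviation (input) "gact \<equiv> V1_gen_act p q l \<mu> lam \<gamma>"
private abbreviation (input) "wact \<equiv> V1_word_act p q l \<mu> lam \<gamma>"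
private abbreviation (input) "vact \<equiv> V1_free_act p q l \<mu> lam \<gamma>"
private abbreviation (input) "carr \<equiv> {v::nat \<Rightarrow> 'k. \<forall>i\<ge>l. v i = 0}"

lemma bact_closed: "k < l \<Longrightarrow> bact g k \<in> carr"
  by (cases g) (auto simp: scale_def basis_vec_def)

lemma gact_closed: "gact g v \<in> carr"
  using bact_closed by (auto simp: V1_gen_act_def)

lemma gact_lin: "gact g (\<lambda>i. \<Sum>j\<in>A. c j * u j i) = (\<lambda>i. \<Sum>j\<in>A. c j * gact g (u j) i)"
  unfolding V1_gen_act_def
  by (rule ext) (simp add: sum_distrib_left sum_distrib_right mult.assoc, rule sum.swap)

lemma wact_lin: "wact w (\<lambda>i. \<Sum>j\<in>A. c j * u j i) = (\<lambda>i. \<Sum>j\<in>A. c j * wact w (u j) i)"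
proof (cases w)
  case (Word xs)
  have "fold gact xs (\<lambda>i. \<Sum>j\<in>A. c j * u j i) = (\<lambda>i. \<Sum>j\<in>A. c j * fold gact xs (u j) i)" for xs
    by (induction xs arbitrary: u) (simp_all add: gact_lin)
  then show ?thesis by (simp add: V1_word_act_def Word)
qed

lemma wact_closed: "v \<in> carr \<Longrightarrow> wact w v \<in> carr"
proof -
  have "v \<in> carr \<Longrightarrow> fold gact xs v \<in> carr" for xs v
  proof (induction xs arbitrary: v)
    case (Cons a xs)
    show ?case using Cons.IH[OF gact_closed] by simp
  qed simp
  then show "v \<in> carr \<Longrightarrow> wact w v \<in> carr" by (simp add: V1_word_act_def)
qed

lemma wact_add: "wact (u + w) v = wact w (wact u v)"
  by (simp add: V1_word_act_def plus_word_def)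

lemma wact_zero: "wact 0 v = v"
  by (simp add: V1_word_act_def zero_word_def)

lemma wact_add_vec: "wact w (\<lambda>i. u i + v i) = (\<lambda>i. wact w u i + wact w v i)"
  using wact_lin[of w "\<lambda>_. 1" "\<lambda>b. if b then u else v" "{True, False}"] by simp

lemma wact_scale: "wact w (\<lambda>i. c * v i) = (\<lambda>i. c * wact w v i)"
  using wact_lin[of w "\<lambda>_. c" "\<lambda>_. v" "{()}"] by simp

lemma vact_superset:
  assumes "finite S" "Poly_Mapping.keys f \<subseteq> S"
  shows "vact f v = (\<lambda>i. \<Sum>w\<in>S. Poly_Mapping.lookup f w * wact w v i)"
  unfolding V1_free_act_def
  by (rule ext, rule sum.mono_neutral_left) (use assms in \<open>auto simp: in_keys_iff\<close>)

lemma vact_zero: "vact 0 v = (\<lambda>i. 0)"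
  by (simp add: V1_free_act_def)

lemma vact_add: "vact (f + g) v = (\<lambda>i. vact f v i + vact g v i)"
proof -
  let ?S = "Poly_Mapping.keys f \<union> Poly_Mapping.keys g"
  have "Poly_Mapping.keys (f + g) \<subseteq> ?S" by (rule Poly_Mapping.keys_add)
  then show ?thesis
    by (simp add: vact_superset[of ?S] lookup_add algebra_simps sum.distrib)
qed

lemma vact_single: "vact (Poly_Mapping.single w c) v = (\<lambda>i. c * wact w v i)"
  by (subst vact_superset[of "{w}"]) auto

lemma vact_uminus: "vact (- f) v = (\<lambda>i. - vact f v i)"
  using vact_add[of "- f" f v] by (simp add: vact_zero fun_eq_iff eq_neg_iff_add_eq_0)

lemma vact_diff: "vact (f - g) v = (\<lambda>i. vact f v i - vact g v i)"
  using vact_add[of f "- g" v] by (simp add: vact_uminus)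

lemma vact_closed: "v \<in> carr \<Longrightarrow> vact f v \<in> carr"
  using wact_closed by (auto simp: V1_free_act_def)

lemma vact_add_vec: "vact f (\<lambda>i. u i + v i) = (\<lambda>i. vact f u i + vact f v i)"
  by (simp add: V1_free_act_def wact_add_vec algebra_simps sum.distrib)

lemma vact_scale: "vact f (\<lambda>i. c * v i) = (\<lambda>i. c * vact f v i)"
  by (simp add: V1_free_act_def wact_scale sum_distrib_left algebra_simps)

lemma vact_zero_vec: "vact f (\<lambda>i. 0) = (\<lambda>i. 0)"
  using vact_scale[of f 0 "\<lambda>_. 0"] by simp

lemma vact_mult: "vact (f * g) v = vact g (vact f v)"
proof (induction f arbitrary: g rule: free_alg_induct)
  case zero
  then show ?case by (simp add: vact_zero vact_zero_vec)
next
  case (add f1 f2)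
  then show ?case by (simp add: distrib_right vact_add vact_add_vec)
next
  case (single u c)
  show ?case
  proof (induction g rule: free_alg_induct)
    case zero
    then show ?case by (simp add: vact_zero)
  next
    case (add g1 g2)
    then show ?case by (simp add: distrib_left vact_add)
  next
    case (single w d)
    then show ?case
      by (simp add: mult_single vact_single wact_add wact_scale mult.assoc mult.left_commute)
  qed
qed

lemma vact_gen: "vact (gen g) v = gact g v"
  by (simp add: gen_def vact_single V1_word_act_def)

lemma vact_const: "vact (const c) v = scale c v"
  by (simp add: const_def vact_single wact_zero scale_def)

lemma vact_one: "vact 1 v = v"
  using vact_const[of 1 v] by (simp add: const_def scale_def single_one)

lemma gact_basis: "k < l \<Longrightarrow> gact g (scale c (basis_vec k)) = scale c (bact g k)"
proof
  fix i assume "k < l"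
  have "gact g (scale c (basis_vec k)) i = (\<Sum>j<l. if j = k then c * bact g k i else 0)"
    unfolding V1_gen_act_def by (rule sum.cong) (auto simp: scale_def basis_vec_def)
  then show "gact g (scale c (basis_vec k)) i = scale c (bact g k) i"
    using \<open>k < l\<close> by (simp add: scale_def)
qed

lemma vec_expand: "v \<in> carr \<Longrightarrow> v = (\<lambda>i. \<Sum>k<l. v k * basis_vec k i)"
proof
  fix i assume "v \<in> carr"
  have "(\<Sum>k<l. v k * basis_vec k i) = (\<Sum>k<l. if k = i then v i else 0)"
    by (rule sum.cong) (auto simp: basis_vec_def)
  then show "v i = (\<Sum>k<l. v k * basis_vec k i)"
    using \<open>v \<in> carr\<close> by (simp add: not_less)
qed

lemma vact_lin: "vact f (\<lambda>i. \<Sum>j\<in>A. c j * u j i) = (\<lambda>i. \<Sum>j\<in>A. c j * vact f (u j) i)"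
  by (induction A rule: infinite_finite_induct)
    (simp_all add: vact_zero_vec vact_add_vec vact_scale)

lemma vact_vanish:
  assumes "\<And>k. k < l \<Longrightarrow> vact f (basis_vec k) = (\<lambda>i. 0)" "v \<in> carr"
  shows "vact f v = (\<lambda>i. 0)"
  by (subst vec_expand[OF assms(2)]) (simp add: vact_lin assms(1))

lemma scale_scale: "scale c (scale d v) = scale (c * d) v"
  by (simp add: scale_def mult.assoc)

lemma gact_basis1: "k < l \<Longrightarrow> gact g (basis_vec k) = bact g k"
  using gact_basis[of k g 1] by (simp add: scale_def)

context
  assumes pq: "p \<noteq> 0" "q \<noteq> 0" "p * q \<noteq> 1" and pl: "p ^ l = 1" and ql: "q ^ l = 1"
    and l: "l > 0" and mu: "\<mu> \<noteq> 0"
begin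

lemma p_last: "p * p ^ (l - Suc 0) = 1"
  using pl l by (cases l) auto

lemma q_last: "q * q ^ (l - Suc 0) = 1"
  using ql l by (cases l) auto

lemma l_ge2: "l \<ge> 2"
proof (rule ccontr)
  assume "\<not> l \<ge> 2"
  then have "l = 1" using l by simp
  then show False using pl ql pq by simp
qed

lemma relation_vanish:
  assumes "r \<in> H_relations p q" "k < l"
  shows "vact r (basis_vec k) = (\<lambda>i. 0)"
proof -
  have [simp]: "l - Suc 0 \<noteq> 0" "l \<noteq> Suc 0" "l - Suc 0 < l" using l_ge2 by auto
  have p1: "p ^ (l - Suc 0) = inverse p" and q1: "q ^ (l - Suc 0) = inverse q"
    using p_last q_last by (simp_all add: inverse_unique)
  have pql: "(p * q) ^ (l - Suc 0) = inverse (p * q)" "q ^ (l - Suc 0) = inverse q"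
    "p ^ (l - Suc 0) = inverse p"
    by (simp_all only: power_mult_distrib p1 q1 inverse_mult_distrib mult.commute)
  have pqn: "p * q - 1 \<noteq> 0" using pq by simp
  consider "r = gen gen_z * gen gen_x - const (inverse p) * (gen gen_x * gen gen_z)"
    | "r = gen gen_z * gen gen_y - const p * (gen gen_y * gen gen_z)"
    | "r = gen gen_y * gen gen_x - const q * (gen gen_x * gen gen_y) - gen gen_z"
    using assms(1) by (auto simp: H_relations_def)
  then show ?thesis
  proof cases
    case 1
    show ?thesis
    proof (cases "k = l - 1")
      case True
      then show ?thesis unfolding 1
        using assms pq l mu p_last
        by (simp add: vact_diff vact_mult vact_gen vact_const gact_basis gact_basis1 scale_scale)
          (simp add: scale_def fun_eq_iff pql)
    next
      case False
      then have "Suc k < l" using assms by simp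
      then show ?thesis unfolding 1 using assms pq False
        by (simp add: vact_diff vact_mult vact_gen vact_const gact_basis gact_basis1 scale_scale)
          (simp add: scale_def fun_eq_iff)
    qed
  next
    case 2
    show ?thesis
    proof (cases k)
      case 0
      then show ?thesis unfolding 2 using assms pq pql
        by (simp add: vact_diff vact_mult vact_gen vact_const gact_basis gact_basis1 scale_scale)
          (simp add: scale_def fun_eq_iff)
    next
      case (Suc j)
      then show ?thesis unfolding 2 using assms pq
        by (simp add: vact_diff vact_mult vact_gen vact_const gact_basis gact_basis1 scale_scale)
          (simp add: scale_def fun_eq_iff)
    qed
  next
    case 3
    have key: "x * ((a - b) / d) - x * ((a - b * e) / d) - x * b = 0"
      if "d = e - 1" "d \<noteq> 0" for a b d e x :: 'k
    proof -
      have "(a - b) / d - (a - b * e) / d = b"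
        using that by (simp add: diff_divide_distrib[symmetric]) (simp add: field_simps)
      then show ?thesis
        by (metis diff_self right_diff_distrib)
    qed
    have E: "C = inverse (q ^ k) * ((p * q) ^ k * lam)" if "C = p ^ k * lam" for k and C :: 'k
      using that pq by (simp add: power_mult_distrib)
    define A where "A j = inverse (q ^ j) * ((p * q * \<gamma> - (p * q) ^ j * lam) / (p * q - 1))" for j
    have qA: "q * A (Suc k) =
        inverse (q ^ k) * ((p * q * \<gamma> - (p * q) ^ k * lam * (p * q)) / (p * q - 1))" for k
    proof -
      have "q * inverse (q ^ Suc k) = inverse (q ^ k)" using pq by simp
      moreover have "(p * q) ^ Suc k * lam = (p * q) ^ k * lam * (p * q)"
        by (simp add: mult_ac)
      ultimately show ?thesis
        unfolding A_def by (metis mult.assoc)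
    qed
    have A: "A k - q * A (Suc k) - p ^ k * lam = 0" for k
      unfolding qA E[OF refl, of k] unfolding A_def by (rule key[OF refl pqn])
    have A0: "A 0 = (p * q * \<gamma> - lam) / (p * q - 1)" by (simp add: A_def)
    have Al: "A l = A 0" using pl ql by (simp add: A_def power_mult_distrib)
    have byy: "V1_basis_act p q l \<mu> lam \<gamma> gen_y j =
        (if j = 0 then scale (inverse \<mu> * A 0) (basis_vec (l - 1))
         else scale (inverse \<mu> * A j) (basis_vec (j - 1)))" for j
      by (simp add: A_def mult.assoc)
    note V1_basis_act.simps(3)[simp del]
    have A': "A k = q * A (Suc k) + p ^ k * lam" for k
      using A[of k] by (simp add: diff_eq_eq)
    have mu_cancel: "inverse \<mu> * a * \<mu> = a" "\<mu> * (inverse \<mu> * a) = a" "\<mu> * (a * (inverse \<mu> * b)) = a * b" for a b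
      using mu by simp_all
    consider "k = 0" | "k = l - Suc 0" | j where "k = Suc j" "k < l - Suc 0"
      using assms(2) by (metis Suc_pred l less_SucE not0_implies_Suc)
    then show ?thesis
    proof cases
      case 1
      then show ?thesis unfolding 3 using l_ge2 A'[of 0]
        by (simp add: vact_diff vact_mult vact_gen vact_const gact_basis gact_basis1 scale_scale byy)
          (simp add: scale_def fun_eq_iff mu_cancel algebra_simps)
    next
      case 2
      then have "Suc k = l" using l by simp
      then have A2: "A k = q * A 0 + p ^ k * lam"
        using A'[of k] Al by simp
      have "Suc (l - Suc (Suc 0)) = l - Suc 0" "l - Suc (Suc 0) \<noteq> l - Suc 0"
        using l_ge2 by simp_all
      then show ?thesis unfolding 3 using l_ge2 A2 2
        by (simp add: vact_diff vact_mult vact_gen vact_const gact_basis gact_basis1 scale_scale byy)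
          (simp add: scale_def fun_eq_iff mu_cancel algebra_simps)
    next
      case (3 j)
      show ?thesis unfolding \<open>r = _\<close> using l_ge2 A'[of k] 3
        by (simp add: vact_diff vact_mult vact_gen vact_const gact_basis gact_basis1 scale_scale byy)
          (simp add: scale_def fun_eq_iff mu_cancel algebra_simps)
    qed
  qed
qed

lemma H_ideal_ideal: "ideal (H_ideal p q) ring_of_type_algebra"
  unfolding H_ideal_def using free_alg_ring
  by (rule ring.genideal_ideal) (simp add: ring_of_type_algebra_def)

lemma H_ideal_vanish:
  assumes "f \<in> H_ideal p q" "v \<in> carr"
  shows "vact f v = (\<lambda>i. 0)"
proof -
  let ?R = "ring_of_type_algebra :: 'k free_alg ring"
  let ?K = "{f. \<forall>v\<in>carr. vact f v = (\<lambda>i. 0)}"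
  interpret R: ring ?R by (rule free_alg_ring)
  have R: "carrier ?R = UNIV" "monoid.mult ?R = (*)" "add ?R = (+)" "zero ?R = 0" "one ?R = 1"
    by (simp_all add: ring_of_type_algebra_def fun_eq_iff)
  have inv: "inv\<^bsub>add_monoid ?R\<^esub> f = - f" for f
    using R.minus_equality[of "- f" f] by (simp add: R a_inv_def)
  have "ideal ?K ?R"
  proof (rule idealI[OF free_alg_ring])
    show "subgroup ?K (add_monoid ?R)"
    proof (rule subgroup.intro)
      show "inv\<^bsub>add_monoid ?R\<^esub> f \<in> ?K" if "f \<in> ?K" for f
        using that unfolding inv by (simp add: vact_uminus)
    qed (simp_all add: R vact_add vact_zero)
    show "x \<otimes>\<^bsub>?R\<^esub> a \<in> ?K" if "a \<in> ?K" for a x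
      using that vact_closed by (auto simp: R vact_mult)
    show "a \<otimes>\<^bsub>?R\<^esub> x \<in> ?K" if "a \<in> ?K" for a x
      using that by (auto simp: R vact_mult vact_zero_vec)
  qed
  moreover have "H_relations p q \<subseteq> ?K"
    using vact_vanish relation_vanish by blast
  ultimately have "H_ideal p q \<subseteq> ?K"
    unfolding H_ideal_def by (rule R.genideal_minimal)
  then show ?thesis using assms by blast
qed

lemma H_class_altdef: "H_class p q f = (\<lambda>h. h + f) ` H_ideal p q"
  by (auto simp: H_class_def a_r_coset_def' ring_of_type_algebra_def)

lemma V1_smult_class:
  assumes "v \<in> carr"
  shows "right_smult (V1 p q l \<mu> lam \<gamma>) v (H_class p q f) = vact f v"
proof -
  interpret ideal "H_ideal p q" ring_of_type_algebra by (rule H_ideal_ideal)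
  have "0 \<in> H_ideal p q"
    using additive_subgroup.zero_closed[OF ideal.axioms(1)[OF H_ideal_ideal]]
    by (simp add: ring_of_type_algebra_def)
  then have "(\<lambda>f. vact f v) ` H_class p q f = {vact f v}"
    using assms by (auto simp: H_class_altdef vact_add H_ideal_vanish image_iff)
  then show ?thesis by (simp add: V1_def)
qed

text \<open>The defining formulas: \<open>v\<^sub>k \<cdot> g\<close> is as prescribed for each generator, and scalars act as scalars.\<close>

lemma V1_smult_gen:
  "k < l \<Longrightarrow> right_smult (V1 p q l \<mu> lam \<gamma>) (basis_vec k) (H_class p q (gen g)) = bact g k"
  by (subst V1_smult_class) (auto simp: basis_vec_def vact_gen gact_basis1[unfolded basis_vec_def])

lemma V1_smult_const:
  "v \<in> carrier (V1 p q l \<mu> lam \<gamma>) \<Longrightarrow>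
    right_smult (V1 p q l \<mu> lam \<gamma>) v (H_class p q (const c)) = scale c v"
  by (subst V1_smult_class) (auto simp: V1_def vact_const)

lemma V1_right_module: "right_module (H_alg p q) (V1 p q l \<mu> lam \<gamma>)"
proof -
  let ?R = "ring_of_type_algebra :: 'k free_alg ring"
  let ?V = "V1 p q l \<mu> lam \<gamma>"
  interpret I: ideal "H_ideal p q" ?R by (rule H_ideal_ideal)
  have R: "carrier ?R = UNIV" "monoid.mult ?R = (*)" "add ?R = (+)" "one ?R = 1"
    by (simp_all add: ring_of_type_algebra_def fun_eq_iff)
  have V: "carrier ?V = carr" "add ?V = (\<lambda>u v i. u i + v i)" "zero ?V = (\<lambda>i. 0)"
    by (simp_all add: V1_def)
  have H_elem: "\<exists>f. a = H_class p q f" if "a \<in> carrier (H_alg p q)" for a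
    using that by (auto simp: H_alg_def FactRing_def A_RCOSETS_def' H_class_def a_r_coset_def')
  have H_add: "H_class p q f \<oplus>\<^bsub>H_alg p q\<^esub> H_class p q g = H_class p q (f + g)" for f g
    using I.a_rcos_sum[of f g] by (simp add: H_alg_def FactRing_def H_class_def R)
  have H_mult: "H_class p q f \<otimes>\<^bsub>H_alg p q\<^esub> H_class p q g = H_class p q (f * g)" for f g
    using I.rcoset_mult_add[of f g] by (simp add: H_alg_def FactRing_def H_class_def R)
  have H_one: "\<one>\<^bsub>H_alg p q\<^esub> = H_class p q 1"
    by (simp add: H_alg_def FactRing_def H_class_def R)
  have "abelian_group ?V"
  proof (rule abelian_groupI)
    show "\<exists>u\<in>carrier ?V. u \<oplus>\<^bsub>?V\<^esub> v = \<zero>\<^bsub>?V\<^esub>" if "v \<in> carrier ?V" for v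
      using that by (intro bexI[of _ "\<lambda>i. - v i"]) (auto simp: V)
  qed (auto simp: V add_ac)
  moreover have "ring (H_alg p q)"
    unfolding H_alg_def by (rule I.quotient_is_ring)
  moreover have "right_module_axioms (H_alg p q) ?V"
  proof
    note smult = V1_smult_class[folded V(1)] and closed = vact_closed[folded V(1)]
    fix v assume v: "v \<in> carrier ?V"
    show "right_smult ?V v \<one>\<^bsub>H_alg p q\<^esub> = v"
      using v by (simp add: H_one smult vact_one)
    fix a assume "a \<in> carrier (H_alg p q)"
    then obtain f where a: "a = H_class p q f" using H_elem by blast
    show "right_smult ?V v a \<in> carrier ?V"
      using v by (simp add: a smult closed)
    show "right_smult ?V (u \<oplus>\<^bsub>?V\<^esub> v) a = right_smult ?V u a \<oplus>\<^bsub>?V\<^esub> right_smult ?V v a"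
      if u: "u \<in> carrier ?V" for u
    proof -
      have "u \<oplus>\<^bsub>?V\<^esub> v \<in> carrier ?V" using u v by (auto simp: V)
      then show ?thesis using u v by (simp add: a smult) (simp add: V vact_add_vec)
    qed
    fix b assume "b \<in> carrier (H_alg p q)"
    then obtain g where b: "b = H_class p q g" using H_elem by blast
    show "right_smult ?V v (a \<oplus>\<^bsub>H_alg p q\<^esub> b) = right_smult ?V v a \<oplus>\<^bsub>?V\<^esub> right_smult ?V v b"
      using v by (simp add: a b H_add smult vact_add) (simp add: V)
    show "right_smult ?V v (a \<otimes>\<^bsub>H_alg p q\<^esub> b) = right_smult ?V (right_smult ?V v a) b"
      using v by (simp add: a b H_mult smult closed vact_mult)
  qed
  ultimately show ?thesis
    by (intro right_module.intro)
qed

end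

end

end

theory Submission
  imports Defs
begin

text \<open>
  On \<open>V\<^sub>1(\<mu>, \<lambda>, \<gamma>)\<close> the element \<open>x\<^sup>l\<close> acts as the scalar \<open>\<mu>\<^sup>l\<close>, while \<open>v\<^sub>k\<close> is a common eigenvector of
  \<open>z\<close> and \<open>(pq - 1)yx + z\<close> with eigenvalues \<open>p\<^sup>k\<lambda>\<close> and \<open>pq q\<^sup>-\<^sup>k\<gamma>\<close>. An isomorphism sends \<open>v\<^sub>0\<close> to a nonzero
  vector that is a common eigenvector with the same eigenvalues, so any index \<open>k\<close> in the support of this vector gives the
  equations. Conversely, rotating the coordinates by \<open>k\<close> places and rescaling the \<open>i\<close>-th one by
  \<open>(\<mu>'/\<mu>)\<^sup>i\<close> intertwines the two actions; \<open>\<mu>\<^sup>l = \<mu>'\<^sup>l\<close> makes the rescaling cyclically consistent.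
\<close>

section \<open>Periodicity modulo \<open>l\<close> and the coefficients of \<open>y\<close>\<close>

lemma mult_order_power_eq_1:
  fixes a :: "'k::field"
  assumes "a \<noteq> 0"
  shows "a ^ mult_order a = 1"
proof -
  let ?R = "ring_of_type_algebra :: 'k ring"
  interpret R: field ?R by (rule field_from_type_algebra)
  interpret group "Multiplicative_Group.mult_of ?R" by (rule R.field_mult_group)
  have a: "a \<in> carrier (Multiplicative_Group.mult_of ?R)"
    using assms by (simp add: ring_of_type_algebra_def)
  have "a [^]\<^bsub>Multiplicative_Group.mult_of ?R\<^esub> n = a ^ n" for n :: nat
    by (induction n) (simp_all add: ring_of_type_algebra_def mult.commute)
  with pow_ord_eq_1[OF a] show ?thesis
    by (simp add: mult_order_def ring_of_type_algebra_def)
qed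

lemma power_mod_period:
  fixes a :: "'k::monoid_mult"
  assumes "a ^ l = 1"
  shows "a ^ (n mod l) = a ^ n"
proof -
  have "a ^ n = a ^ (l * (n div l) + n mod l)"
    by simp
  also have "\<dots> = a ^ (n mod l)"
    by (simp only: power_add power_mult assms power_one mult_1)
  finally show ?thesis ..
qed

text \<open>This is the coefficient of v_k y without the factor \<open>inverse \<mu>\<close>. At
  \<open>k = 0\<close> both powers are 1, so the separate formula for v_0 y is covered and the index
  can run cyclically.\<close>

definition y_coeff :: "'k::field \<Rightarrow> 'k \<Rightarrow> 'k \<Rightarrow> 'k \<Rightarrow> nat \<Rightarrow> 'k"
  where "y_coeff p q lam \<gamma> k = inverse (q ^ k) * ((p * q * \<gamma> - (p * q) ^ k * lam) / (p * q - 1))"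

lemma y_coeff_mod:
  fixes p q :: "'k::field"
  assumes "p ^ l = 1" "q ^ l = 1"
  shows "y_coeff p q lam \<gamma> (k mod l) = y_coeff p q lam \<gamma> k"
  by (simp add: y_coeff_def power_mult_distrib power_mod_period assms)

text \<open>Distributing \<open>inverse (q ^ k)\<close> over the numerator turns an index shift into
  a change of parameters. This is the source of the substitution \<open>p ^ k\<close>,
  \<open>inverse (q ^ k)\<close> in the theorem.\<close>

lemma y_coeff_add:
  fixes p q :: "'k::field"
  assumes "q \<noteq> 0"
  shows "y_coeff p q lam \<gamma> (j + k) = y_coeff p q (p ^ k * lam) (inverse (q ^ k) * \<gamma>) j"
proof -
  have "inverse (q ^ (j + k)) * (p * q * \<gamma> - (p * q) ^ (j + k) * lam) =
      inverse (q ^ j) * (p * q * (inverse (q ^ k) * \<gamma>) - (p * q) ^ j * (p ^ k * lam))"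
    using assms by (simp add: power_add power_mult_distrib field_simps)
  then show ?thesis
    by (simp add: y_coeff_def)
qed

text \<open>Multiplying by \<open>p * q - 1\<close> clears the denominator, and
  \<open>inverse (q ^ k) * (p * q) ^ k = p ^ k\<close> makes the two \<open>lam\<close> terms
  cancel.\<close>

lemma y_coeff_casimir:
  fixes p q :: "'k::field"
  assumes "q \<noteq> 0" "p * q \<noteq> 1"
  shows "(p * q - 1) * y_coeff p q lam \<gamma> k + p ^ k * lam = p * q * inverse (q ^ k) * \<gamma>"
proof -
  have "(p * q - 1) * y_coeff p q lam \<gamma> k = inverse (q ^ k) * (p * q * \<gamma> - (p * q) ^ k * lam)"
    using assms by (simp add: y_coeff_def)
  then show ?thesis
    using assms by (simp add: power_mult_distrib right_diff_distrib)
qed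

section \<open>The generators in coordinates\<close>

lemma V1_gen_act_z:
  assumes "i < l"
  shows "V1_gen_act p q l \<mu> lam \<gamma> gen_z v i = p ^ i * lam * v i"
proof -
  have "V1_gen_act p q l \<mu> lam \<gamma> gen_z v i = (\<Sum>k<l. if k = i then p ^ i * lam * v i else 0)"
    unfolding V1_gen_act_def by (rule sum.cong) (auto simp: scale_def basis_vec_def)
  then show ?thesis using assms by simp
qed

text \<open>The cyclic predecessor is written as adding \<open>l - 1\<close>, which avoids truncated
  subtraction at 0. It serves \<open>x\<close>, which raises the index, and \<open>y\<close>, which
  lowers it.\<close>

lemma Suc_mod_eq_iff:
  fixes i k l :: nat
  assumes "i < l" "k < l"
  shows "Suc k mod l = i \<longleftrightarrow> k = (i + (l - 1)) mod l"
proof -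
  have succ: "Suc k mod l = (if Suc k = l then 0 else Suc k)"
    using assms(2) by simp
  show ?thesis
  proof (cases i)
    case 0
    then have pred: "(i + (l - 1)) mod l = l - 1"
      using assms(1) by simp
    show ?thesis
      by (simp only: succ pred) (use 0 assms(2) in auto)
  next
    case (Suc j)
    then have "i + (l - 1) = j + l"
      using assms(1) by simp
    then have pred: "(i + (l - 1)) mod l = j"
      using assms(1) Suc by (simp only: mod_add_self2 mod_less Suc_lessD)
    show ?thesis
      by (simp only: succ pred) (use Suc assms in auto)
  qed
qed

lemma V1_gen_act_x:
  assumes "i < l"
  shows "V1_gen_act p q l \<mu> lam \<gamma> gen_x v i = \<mu> * v ((i + (l - 1)) mod l)"
proof -
  define j where "j = (i + (l - 1)) mod l"
  have "V1_gen_act p q l \<mu> lam \<gamma> gen_x v i = (\<Sum>k<l. if k = j then \<mu> * v j else 0)"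
    unfolding V1_gen_act_def
  proof (rule sum.cong)
    fix k assume "k \<in> {..<l}"
    then have k: "k < l" by simp
    have "V1_basis_act p q l \<mu> lam \<gamma> gen_x k = scale \<mu> (basis_vec (Suc k mod l))"
      using k by (auto simp: mod_Suc)
    then show "v k * V1_basis_act p q l \<mu> lam \<gamma> gen_x k i = (if k = j then \<mu> * v j else 0)"
      using Suc_mod_eq_iff[OF assms k] by (auto simp: scale_def basis_vec_def j_def)
  qed simp
  moreover have "j < l" using assms by (simp add: j_def)
  ultimately show ?thesis by (simp add: j_def)
qed

text \<open>Only v_(i+1) contributes to coordinate \<open>i\<close>. The coefficient keeps the
  unreduced index \<open>Suc i\<close>, which for \<open>i = l - 1\<close> agrees with index 0 by
  periodicity.\<close>

lemma V1_gen_act_y: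
  fixes p q :: "'k::field"
  assumes "i < l" "p ^ l = 1" "q ^ l = 1"
  shows "V1_gen_act p q l \<mu> lam \<gamma> gen_y v i =
    inverse \<mu> * y_coeff p q lam \<gamma> (Suc i) * v (Suc i mod l)"
proof -
  define j where "j = Suc i mod l"
  have "V1_gen_act p q l \<mu> lam \<gamma> gen_y v i =
      (\<Sum>k<l. if k = j then inverse \<mu> * y_coeff p q lam \<gamma> j * v j else 0)"
    unfolding V1_gen_act_def
  proof (rule sum.cong)
    fix k assume "k \<in> {..<l}"
    then have k: "k < l" by simp
    have "V1_basis_act p q l \<mu> lam \<gamma> gen_y k =
        scale (inverse \<mu> * y_coeff p q lam \<gamma> k) (basis_vec ((k + (l - 1)) mod l))"
    proof (cases k)
      case 0
      then show ?thesis using k by (simp add: y_coeff_def)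
    next
      case (Suc k')
      then have "k + (l - 1) = k' + l" using k by simp
      then have "(k + (l - 1)) mod l = k'" using Suc k by simp
      then show ?thesis using Suc by (simp add: y_coeff_def mult.assoc)
    qed
    then show "v k * V1_basis_act p q l \<mu> lam \<gamma> gen_y k i =
        (if k = j then inverse \<mu> * y_coeff p q lam \<gamma> j * v j else 0)"
      using Suc_mod_eq_iff[OF k assms(1)] by (auto simp: scale_def basis_vec_def j_def)
  qed simp
  moreover have "j < l" using assms by (simp add: j_def)
  ultimately show ?thesis using assms by (simp add: j_def y_coeff_mod)
qed

section \<open>Elements acting as scalars or diagonally\<close>

lemma V1_free_act_x_power:
  assumes "i < l"
  shows "V1_free_act p q l \<mu> lam \<gamma> (gen gen_x ^ n) v i = \<mu> ^ n * v ((i + n * (l - 1)) mod l)"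
  using assms
proof (induction n arbitrary: i)
  case 0
  then show ?case by (simp add: vact_one)
next
  case (Suc n)
  have l: "l > 0" using Suc.prems by simp
  have "((i + (l - 1)) mod l + n * (l - 1)) mod l = (i + Suc n * (l - 1)) mod l"
    by (simp only: mod_add_left_eq mult_Suc add.assoc)
  \<comment> \<open>\<open>power_Suc2\<close> splits off the last factor, which acts last. The
    induction hypothesis is then needed at the predecessor of \<open>i\<close>, with the same
    \<open>v\<close>.\<close>
  then show ?case using Suc l
    by (simp add: power_Suc2 vact_mult vact_gen V1_gen_act_x del: power_Suc)
qed

text \<open>A shift by \<open>l * (l - 1)\<close> places returns every coordinate to itself.\<close>

lemma V1_free_act_x_power_period:
  assumes "v \<in> carrier (V1 p q l \<mu> lam \<gamma>)"
  shows "V1_free_act p q l \<mu> lam \<gamma> (gen gen_x ^ l) v = scale (\<mu> ^ l) v"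
proof
  fix i
  have v: "v \<in> {v. \<forall>i\<ge>l. v i = 0}"
    using assms by (simp add: V1_def)
  show "V1_free_act p q l \<mu> lam \<gamma> (gen gen_x ^ l) v i = scale (\<mu> ^ l) v i"
  proof (cases "i < l")
    case True
    then show ?thesis by (simp add: V1_free_act_x_power scale_def)
  next
    case False
    then show ?thesis using v vact_closed[OF v] by (auto simp: scale_def)
  qed
qed

text \<open>Modulo the relations this is q(p yx - xy). It is not central in general, but it is
  diagonal on the basis with eigenvalues that involve \<open>\<gamma>\<close> and not
  \<open>lam\<close>, complementing \<open>z\<close>.\<close>

definition casimir :: "'k::field \<Rightarrow> 'k \<Rightarrow> 'k free_alg"
  where "casimir p q = const (p * q - 1) * (gen gen_y * gen gen_x) + gen gen_z"

lemma V1_free_act_casimir: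
  fixes p q :: "'k::field"
  assumes "i < l" "p ^ l = 1" "q ^ l = 1" "q \<noteq> 0" "p * q \<noteq> 1" "\<mu> \<noteq> 0"
  shows "V1_free_act p q l \<mu> lam \<gamma> (casimir p q) v i = p * q * inverse (q ^ i) * \<gamma> * v i"
proof -
  let ?j = "(i + (l - 1)) mod l"
  have j: "?j < l" "Suc ?j mod l = i"
    using assms(1) Suc_mod_eq_iff[of i l ?j] by simp_all
  \<comment> \<open>For \<open>i = 0\<close> the index \<open>Suc ?j\<close> is \<open>l\<close>, so
    periodicity is needed here.\<close>
  have "y_coeff p q lam \<gamma> (Suc ?j) = y_coeff p q lam \<gamma> i"
    using y_coeff_mod[OF assms(2,3), of lam \<gamma> "Suc ?j"] by (simp only: j)
  then have yx: "V1_gen_act p q l \<mu> lam \<gamma> gen_x (V1_gen_act p q l \<mu> lam \<gamma> gen_y v) i =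
      y_coeff p q lam \<gamma> i * v i"
    by (simp only: V1_gen_act_x[OF assms(1)] V1_gen_act_y[OF j(1) assms(2,3)] j(2)
        mult.assoc[symmetric] right_inverse[OF assms(6)] mult_1_left)
  have "V1_free_act p q l \<mu> lam \<gamma> (casimir p q) v i =
      V1_free_act p q l \<mu> lam \<gamma> (gen gen_y * gen gen_x) (scale (p * q - 1) v) i + p ^ i * lam * v i"
    by (simp only: casimir_def vact_add vact_mult vact_gen vact_const V1_gen_act_z[OF assms(1)])
  also have "\<dots> = ((p * q - 1) * y_coeff p q lam \<gamma> i + p ^ i * lam) * v i"
    by (simp only: scale_def vact_scale) (simp only: vact_mult vact_gen yx distrib_right mult.assoc)
  also have "\<dots> = p * q * inverse (q ^ i) * \<gamma> * v i"
    by (simp only: y_coeff_casimir[OF assms(4,5)])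
  finally show ?thesis .
qed

section \<open>The intertwining rotation\<close>

definition twisted_rotation :: "'k::field \<Rightarrow> nat \<Rightarrow> nat \<Rightarrow> (nat \<Rightarrow> 'k) \<Rightarrow> nat \<Rightarrow> 'k"
  where "twisted_rotation c l k v = (\<lambda>i. if i < l then c ^ i * v ((i + k) mod l) else 0)"

text \<open>The index shift by \<open>k\<close> is absorbed by the new \<open>lam'\<close> and
  \<open>\<gamma>'\<close>. Moving one place along the cycle changes the weight \<open>c ^ i\<close>
  by a factor \<open>c\<close> or its inverse, which exchanges \<open>\<mu>\<close> for
  \<open>\<mu>'\<close> in the actions of \<open>x\<close> and \<open>y\<close>.\<close>

lemma twisted_rotation_gen_act:
  fixes p q c :: "'k::field"
  assumes "p ^ l = 1" "q ^ l = 1" "q \<noteq> 0" "\<mu> \<noteq> 0" "\<mu>' \<noteq> 0" "\<mu> ^ l = \<mu>' ^ l"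
    and c: "c = \<mu>' / \<mu>"
    and "lam' = p ^ k * lam" "\<gamma>' = inverse (q ^ k) * \<gamma>"
  shows "twisted_rotation c l k (V1_gen_act p q l \<mu> lam \<gamma> g v) =
    V1_gen_act p q l \<mu>' lam' \<gamma>' g (twisted_rotation c l k v)"
proof
  fix i
  \<comment> \<open>Here the equality of the \<open>l\<close>-th powers enters: the weights
    \<open>c ^ i\<close> close up around the cycle.\<close>
  have cl: "c ^ l = 1"
    using assms by (simp add: power_divide)
  show "twisted_rotation c l k (V1_gen_act p q l \<mu> lam \<gamma> g v) i =
    V1_gen_act p q l \<mu>' lam' \<gamma>' g (twisted_rotation c l k v) i"
  proof (cases "i < l")
    case False
    then show ?thesis
      using gact_closed[of p q l \<mu>' lam' \<gamma>' g "twisted_rotation c l k v"]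
      by (simp add: twisted_rotation_def)
  next
    case i: True
    then have l: "l > 0" by simp
    show ?thesis
    proof (cases g)
      case gen_x
      \<comment> \<open>The exponent \<open>i + (l - 1)\<close> stands for i - 1, also when
        \<open>i = 0\<close>.\<close>
      have "\<mu>' * c ^ (i + (l - 1)) = \<mu> * (c ^ i * (c ^ (l - 1) * c))"
        using c assms(4) by (simp add: power_add)
      also have "c ^ (l - 1) * c = 1"
        using cl power_minus_mult[OF l, of c] by simp
      finally have coeff: "\<mu>' * c ^ (i + (l - 1)) = \<mu> * c ^ i"
        by simp
      have index: "((i + (l - 1)) mod l + k) mod l = ((i + k) mod l + (l - 1)) mod l"
        by (simp only: mod_add_left_eq add.assoc add.commute[of k])
      have "twisted_rotation c l k (V1_gen_act p q l \<mu> lam \<gamma> g v) i =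
          \<mu> * c ^ i * v (((i + k) mod l + (l - 1)) mod l)"
        using i l by (simp only: twisted_rotation_def gen_x V1_gen_act_x mod_less_divisor if_True mult_ac)
      also have "\<dots> = \<mu>' * c ^ (i + (l - 1)) * v (((i + (l - 1)) mod l + k) mod l)"
        by (simp only: coeff index)
      also have "\<dots> = V1_gen_act p q l \<mu>' lam' \<gamma>' g (twisted_rotation c l k v) i"
        using i l by (simp only: twisted_rotation_def gen_x V1_gen_act_x mod_less_divisor if_True mult_ac
            power_mod_period[OF cl])
      finally show ?thesis .
    next
      case gen_z
      show ?thesis
        using i l assms(1,8)
        by (simp add: gen_z V1_gen_act_z twisted_rotation_def power_mod_period power_add)
    next
      case gen_y
      let ?y = "y_coeff p q lam' \<gamma>' (Suc i)"
      have "y_coeff p q lam \<gamma> (Suc ((i + k) mod l)) = y_coeff p q lam \<gamma> (Suc i + k)"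
        using y_coeff_mod[OF assms(1,2)] by (metis add_Suc mod_Suc_eq)
      also have "\<dots> = ?y"
        unfolding assms(8,9) by (rule y_coeff_add[OF assms(3)])
      finally have y: "y_coeff p q lam \<gamma> (Suc ((i + k) mod l)) = ?y" .
      have coeff: "inverse \<mu>' * c ^ Suc i = inverse \<mu> * c ^ i"
        using c assms(4,5) by (simp add: divide_inverse)
      have index: "Suc ((i + k) mod l) mod l = (Suc i mod l + k) mod l"
        by (simp only: mod_add_left_eq mod_Suc_eq add_Suc)
      have "twisted_rotation c l k (V1_gen_act p q l \<mu> lam \<gamma> g v) i =
          inverse \<mu> * c ^ i * ?y * v (Suc ((i + k) mod l) mod l)"
        using i l by (simp only: twisted_rotation_def gen_y V1_gen_act_y[OF _ assms(1,2)] y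
            mod_less_divisor if_True mult_ac)
      also have "\<dots> = inverse \<mu>' * c ^ Suc i * ?y * v ((Suc i mod l + k) mod l)"
        by (simp only: coeff index)
      also have "\<dots> = V1_gen_act p q l \<mu>' lam' \<gamma>' g (twisted_rotation c l k v) i"
        using i l by (simp only: twisted_rotation_def gen_y V1_gen_act_y[OF _ assms(1,2)]
            mod_less_divisor if_True mult_ac power_mod_period[OF cl])
      finally show ?thesis .
    qed
  qed
qed

text \<open>Words act as composites of letters, and the rotation is linear, so intertwining extends
  from generators to the free algebra.\<close>

lemma twisted_rotation_free_act:
  assumes gen: "\<And>g v. twisted_rotation c l k (V1_gen_act p q l \<mu> lam \<gamma> g v) =
    V1_gen_act p q l \<mu>' lam' \<gamma>' g (twisted_rotation c l k v)"
  shows "twisted_rotation c l k (V1_free_act p q l \<mu> lam \<gamma> f v) =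
    V1_free_act p q l \<mu>' lam' \<gamma>' f (twisted_rotation c l k v)"
proof -
  have "twisted_rotation c l k (fold (V1_gen_act p q l \<mu> lam \<gamma>) xs v) =
      fold (V1_gen_act p q l \<mu>' lam' \<gamma>') xs (twisted_rotation c l k v)" for xs
    by (induction xs arbitrary: v) (simp_all add: gen)
  then have word: "V1_word_act p q l \<mu>' lam' \<gamma>' w (twisted_rotation c l k v) =
      twisted_rotation c l k (V1_word_act p q l \<mu> lam \<gamma> w v)" for w
    by (simp add: V1_word_act_def)
  show ?thesis
    unfolding V1_free_act_def word
    by (simp add: twisted_rotation_def fun_eq_iff sum_distrib_left mult.left_commute)
qed

lemma bij_betw_twisted_rotation:
  fixes c :: "'k::field"
  assumes "c \<noteq> 0"
  shows "bij_betw (twisted_rotation c l k) {v. \<forall>i\<ge>l. v i = 0} {v. \<forall>i\<ge>l. v i = 0}"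
proof -
  \<comment> \<open>A natural number that is the negative of \<open>k\<close> modulo
    \<open>l\<close>, for \<open>k\<close> of any size.\<close>
  define k' where "k' = l * k - k"
  have shift: "((i + k) mod l + k') mod l = i" "((i + k') mod l + k) mod l = i" if "i < l" for i
  proof -
    have "k \<le> l * k"
      using that by (cases l) simp_all
    then have "i + k + k' = i + l * k" "i + k' + k = i + l * k"
      unfolding k'_def by linarith+
    then show "((i + k) mod l + k') mod l = i" "((i + k') mod l + k) mod l = i"
      using that by (simp_all only: mod_add_left_eq mod_mult_self2 mod_less)
  qed
  define r where "r u = (\<lambda>i. if i < l then inverse (c ^ ((i + k') mod l)) * u ((i + k') mod l) else 0)"
    for u :: "nat \<Rightarrow> 'k"
  show ?thesis
  proof (rule bij_betw_byWitness[where f' = r])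
    show "\<forall>v\<in>{v. \<forall>i\<ge>l. v i = 0}. r (twisted_rotation c l k v) = v"
      using assms shift by (auto simp: r_def twisted_rotation_def fun_eq_iff)
    show "\<forall>v\<in>{v. \<forall>i\<ge>l. v i = 0}. twisted_rotation c l k (r v) = v"
      using assms shift by (auto simp: r_def twisted_rotation_def fun_eq_iff)
  qed (auto simp: r_def twisted_rotation_def)
qed

section \<open>Passing to cosets, and the isomorphism criterion\<close>

lemma H_alg_carrier: "carrier (H_alg p q) = range (H_class p q)"
  by (auto simp: H_alg_def FactRing_def A_RCOSETS_def' H_class_def a_r_coset_def'
      ring_of_type_algebra_def)

theorem proposition7p1:
  fixes p q \<mu> lam \<gamma> \<mu>' lam' \<gamma>' :: "'k::alg_closed_field" and m n l :: nat
  assumes "p \<noteq> 0" "q \<noteq> 0" "p * q \<noteq> 1"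
    and "mult_order p = m" "m > 0"
    and "mult_order q = n" "n > 0"
    and "l = lcm m n"
    and "\<mu> \<noteq> 0" "lam \<noteq> 0" "\<gamma> \<noteq> 0"
    and "\<mu>' \<noteq> 0" "lam' \<noteq> 0" "\<gamma>' \<noteq> 0"
  shows "right_module_isomorphic (H_alg p q) (V1 p q l \<mu> lam \<gamma>) (V1 p q l \<mu>' lam' \<gamma>') \<longleftrightarrow>
    \<mu> ^ l = \<mu>' ^ l \<and> (\<exists>k. k \<le> l - 1 \<and> lam = p ^ k * lam' \<and> \<gamma> = inverse (q ^ k) * \<gamma>')"
proof -
  let ?V = "V1 p q l \<mu> lam \<gamma>" and ?V' = "V1 p q l \<mu>' lam' \<gamma>'"
  let ?act = "V1_free_act p q l \<mu> lam \<gamma>" and ?act' = "V1_free_act p q l \<mu>' lam' \<gamma>'"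
  have l: "l > 0"
    using assms(5,7,8) by (simp add: lcm_pos_nat)
  have "p ^ m = 1" "q ^ n = 1"
    using mult_order_power_eq_1 assms(1,2,4,6) by blast+
  moreover have "m dvd l" "n dvd l" using assms(8) by simp_all
  ultimately have pl: "p ^ l = 1" and ql: "q ^ l = 1"
    by (metis dvd_def power_mult power_one)+
  have carr: "carrier ?V = {v. \<forall>i\<ge>l. v i = 0}" "carrier ?V' = {v. \<forall>i\<ge>l. v i = 0}"
    by (simp_all add: V1_def)
  have smult: "right_smult ?V v (H_class p q f) = ?act f v" if "v \<in> carrier ?V" for v f
    by (rule V1_smult_class) (use that assms l pl ql carr in auto)
  have smult': "right_smult ?V' v (H_class p q f) = ?act' f v" if "v \<in> carrier ?V'" for v f
    by (rule V1_smult_class) (use that assms l pl ql carr in auto)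
  have add: "u \<oplus>\<^bsub>?V\<^esub> v = (\<lambda>i. u i + v i)" "u \<oplus>\<^bsub>?V'\<^esub> v = (\<lambda>i. u i + v i)" for u v
    by (simp_all add: V1_def)
  show ?thesis
  proof
    assume "right_module_isomorphic (H_alg p q) ?V ?V'"
    then obtain \<phi> where hom: "\<phi> \<in> right_module_hom (H_alg p q) ?V ?V'"
      and bij: "bij_betw \<phi> (carrier ?V) (carrier ?V')"
      by (auto simp: right_module_isomorphic_def)
    have act: "\<phi> (?act f v) = ?act' f (\<phi> v)" if "v \<in> carrier ?V" for f v
    proof -
      have "\<phi> (right_smult ?V v (H_class p q f)) = right_smult ?V' (\<phi> v) (H_class p q f)"
        and "\<phi> v \<in> carrier ?V'"
        using hom that unfolding right_module_hom_def H_alg_carrier by blast+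
      then show ?thesis
        using that by (simp only: smult smult')
    qed
    let ?e = "basis_vec 0 :: nat \<Rightarrow> 'k"
    define u where "u = \<phi> ?e"
    have e: "?e \<in> carrier ?V" using l by (auto simp: carr basis_vec_def)
    have u: "u \<in> carrier ?V'" using e hom by (auto simp: u_def right_module_hom_def)
    \<comment> \<open>A module homomorphism is only required to be additive and compatible with the
      algebra. Its linearity over the field comes from letting \<open>const c\<close> act.\<close>
    have scalar: "?act' f u = scale c u" if "?act f ?e = scale c ?e" for f c
      using that act[OF e, of f] act[OF e, of "const c"] by (simp add: vact_const u_def)
    have eigen: "?act f ?e = scale c ?e" if "\<And>i. i < l \<Longrightarrow> ?act f ?e i = c * ?e i" for f c
    proof
      fix i
      show "?act f ?e i = scale c ?e i"
        using that[of i] vact_closed[of ?e l p q \<mu> lam \<gamma> f] e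
        by (cases "i < l") (auto simp: carr scale_def)
    qed
    have "u \<noteq> (\<lambda>i. 0)"
    proof
      assume "u = (\<lambda>i. 0)"
      \<comment> \<open>Acting by the zero of the free algebra shows that zero goes to zero;
        injectivity then gives the contradiction.\<close>
      moreover have "\<phi> (\<lambda>i. 0) = (\<lambda>i. 0)"
        using act[OF e, of 0] by (simp add: vact_zero)
      ultimately have "?e = (\<lambda>i. 0)"
        using bij e unfolding u_def bij_betw_def inj_on_def by (auto simp: carr)
      then show False by (metis basis_vec_def zero_neq_one)
    qed
    \<comment> \<open>One index is fixed before comparing coordinates, since the same
      \<open>k\<close> must serve both \<open>lam\<close> and \<open>\<gamma>\<close>.\<close>
    then obtain k where k: "u k \<noteq> 0" by auto
    then have kl: "k < l" using u by (auto simp: carr not_less[symmetric])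
    have "?act' (gen gen_x ^ l) u = scale (\<mu> ^ l) u"
      by (intro scalar V1_free_act_x_power_period e)
    then have "\<mu> ^ l = \<mu>' ^ l"
      using V1_free_act_x_power_period[OF u] k by (metis mult_right_cancel scale_def)
    moreover have "?act' (gen gen_z) u = scale lam u"
      by (intro scalar eigen) (auto simp: vact_gen V1_gen_act_z basis_vec_def)
    then have "p ^ k * lam' * u k = lam * u k"
      using kl by (metis vact_gen V1_gen_act_z scale_def)
    then have "lam = p ^ k * lam'" using k by simp
    moreover have "?act' (casimir p q) u = scale (p * q * \<gamma>) u"
      using pl ql assms(2,3,9)
      by (intro scalar eigen) (auto simp: V1_free_act_casimir basis_vec_def)
    then have "p * q * inverse (q ^ k) * \<gamma>' * u k = p * q * \<gamma> * u k"
      using V1_free_act_casimir[OF kl pl ql assms(2,3,12)] by (metis scale_def)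
    then have "\<gamma> = inverse (q ^ k) * \<gamma>'"
      using k assms(1,2) by simp
    ultimately show "\<mu> ^ l = \<mu>' ^ l \<and>
        (\<exists>k. k \<le> l - 1 \<and> lam = p ^ k * lam' \<and> \<gamma> = inverse (q ^ k) * \<gamma>')"
      using kl by (intro conjI exI[of _ k]) auto
  next
    assume "\<mu> ^ l = \<mu>' ^ l \<and>
        (\<exists>k. k \<le> l - 1 \<and> lam = p ^ k * lam' \<and> \<gamma> = inverse (q ^ k) * \<gamma>')"
    then obtain k where mu: "\<mu> ^ l = \<mu>' ^ l" and kl: "k \<le> l - 1"
      and lam: "lam = p ^ k * lam'" and gam: "\<gamma> = inverse (q ^ k) * \<gamma>'"
      by blast
    \<comment> \<open>The hypothesis expresses the unprimed parameters by the primed ones, while the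
      rotation lemma needs the converse, so the rotation goes the other way round the cycle. For
      \<open>k = 0\<close> this gives the harmless full turn \<open>j = l\<close>.\<close>
    define j where "j = l - k"
    have "p ^ j * p ^ k = 1" "q ^ j * q ^ k = 1"
      using kl pl ql by (simp_all add: j_def flip: power_add)
    then have lam': "lam' = p ^ j * lam" and gam': "\<gamma>' = inverse (q ^ j) * \<gamma>"
      unfolding lam gam by (metis mult.assoc mult_1_left inverse_1 inverse_mult_distrib)+
    define \<phi> where "\<phi> = twisted_rotation (\<mu>' / \<mu>) l j"
    have act: "\<phi> (?act f v) = ?act' f (\<phi> v)" for f v
      unfolding \<phi>_def
      by (intro twisted_rotation_free_act twisted_rotation_gen_act pl ql assms(2,9,12) mu lam' gam' refl)
    have bij: "bij_betw \<phi> (carrier ?V) (carrier ?V')"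
      unfolding \<phi>_def carr using assms(9,12) by (intro bij_betw_twisted_rotation) simp
    have closed: "\<phi> v \<in> carrier ?V'" if "v \<in> carrier ?V" for v
      using bij that by (rule bij_betwE[rule_format])
    moreover have "\<phi> (u \<oplus>\<^bsub>?V\<^esub> v) = \<phi> u \<oplus>\<^bsub>?V'\<^esub> \<phi> v" for u v
      by (simp add: add \<phi>_def twisted_rotation_def fun_eq_iff distrib_left)
    moreover have "\<phi> (right_smult ?V v a) = right_smult ?V' (\<phi> v) a"
      if "v \<in> carrier ?V" "a \<in> carrier (H_alg p q)" for v a
      using that closed by (auto simp: H_alg_carrier smult smult' act)
    ultimately have "\<phi> \<in> right_module_hom (H_alg p q) ?V ?V'"
      by (simp add: right_module_hom_def)
    with bij show "right_module_isomorphic (H_alg p q) ?V ?V'"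
      by (auto simp: right_module_isomorphic_def)
  qed
qed

end
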